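(* Let $\mathcal{P}=\{P_k\}_{k=0}^\infty$ be a sequence of polynomials in $\mathbb{R}[x]$ such that $\deg(P_k)=k$ for all $k\in\mathbb{N}$. (i) Suppose that there are real numbers $a\neq 0$, $b\ge 0$ and real numbers $c_k$ ($k\in\mathbb{N}$) with $c_{k+1}\ge c_k>0$ for all $k\in\mathbb{N}$, such that $$P_{k+1}(x)=a(x+b)(D+c_k)P_k(x)\qquad\text{for all } k\in\mathbb{N}.$$ Then the polynomial $\mathscr{T}_k(\mathcal{P};x-b)$ (in the variable $x$) is weakly Hurwitz stable for all $k\in\mathbb{N}$. (ii) Suppose that there are real numbers $a>0$, $b$, $c$ such that $$P_{k+1}(x)=c(-ax+b+D)P_k(x)\qquad\text{for all } k\in\mathbb{N}.$$ Then for each $k\ge 1$ all $k$ zeros of $P_k$ are real. Moreover, letting $M_k$ denote the largest and $m_k$ the smallest zero of $P_k$ for each $k\ge 1$, for each $k\in\mathbb{N}$ one has $\mathscr{T}_k(\mathcal{P};x)\neq 0$ for every $x\in\mathbb{C}$ with $\operatorname{Re} x>M_{k+1}$ or $\operatorname{Re} x<m_{k+1}$. (iii) Suppose that $$(xD-k)P_k(x)=P_{k-1}(x)\qquad\text{for all } k\ge 1,$$ and that each $P_k$ has only real non-positive zeros. Then $\mathscr{T}_k(\mathcal{P};x)$ is weakly Hurwitz stable for all $k\in\mathbb{N}$.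
   Context: $\mathbb{N}=\{0,1,2,\dots\}$ and $D=\partial/\partial x$ denotes differentiation with respect to $x$; thus $(D+c)P=P'+cP$, $(-ax+b+D)P=(-ax+b)P+P'$ and $(xD-k)P=xP'-kP$. For a sequence of polynomials $\mathcal{P}=\{P_k\}_{k=0}^\infty$, the $k$-th Turán expression is $$\mathscr{T}_k(\mathcal{P};x)=(P_{k+1}(x))^2-P_{k+2}(x)P_k(x),\qquad k\in\mathbb{N}.$$ The notation $\mathscr{T}_k(\mathcal{P};x-b)$ means that $x$ is replaced by $x-b$ in this polynomial. A polynomial in $\mathbb{C}[x]$ is called weakly Hurwitz stable if it is non-zero at every $x\in\mathbb{C}$ with $\operatorname{Re} x>0$. *)

theory Defs
  imports Complex_Main "HOL-Computational_Algebra.Computational_Algebra"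
begin

definition turan :: "(nat \<Rightarrow> real poly) \<Rightarrow> nat \<Rightarrow> real poly" where
  "turan P k = P (k + 1) ^ 2 - P (k + 2) * P k"

abbreviation complex_poly :: "real poly \<Rightarrow> complex poly" where
  "complex_poly p \<equiv> map_poly complex_of_real p"

definition weakly_hurwitz_stable :: "complex poly \<Rightarrow> bool" where
  "weakly_hurwitz_stable p \<longleftrightarrow> (\<forall>z. Re z > 0 \<longrightarrow> poly p z \<noteq> 0)"

text \<open>The largest and smallest real zero. They are meaningful only for a nonzero polynomial that
  has a real zero; they are the extreme zeros outright when all complex zeros are real.\<close>

definition largest_zero :: "real poly \<Rightarrow> real" where
  "largest_zero p = Max {x. poly p x = 0}"

definition smallest_zero :: "real poly \<Rightarrow> real" where
  "smallest_zero p = Min {x. poly p x = 0}"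

end

theory Submission
  imports Defs
begin

text \<open>
  At a point \<open>z\<close> put \<open>L = (\<Sum>i. 1/(z - r\<^sub>i))\<close> and \<open>M = (\<Sum>i. 1/(z - r\<^sub>i)\<^sup>2)\<close>, where the \<open>r\<^sub>i\<close> are the zeros of
  \<open>p = P\<^sub>k\<close> (of \<open>p = P\<^bsub>k+2\<^esub>\<close> in part (iii)). Then \<open>p' = p L\<close> and \<open>p'' = p (L\<^sup>2 - M)\<close>, and the recurrence turns
  the Turan expression into an explicit non-zero factor times \<open>a + M\<close> in part (ii), and
  \<open>\<Sum>i. r\<^sub>i\<^sup>2/(z - r\<^sub>i)\<^sup>2\<close> in part (iii). To the right of all the \<open>r\<^sub>i\<close> (or to the left of
  all of them) the non-zero imaginary parts of the \<open>1/(z - r\<^sub>i)\<^sup>2\<close> have a common sign, so these sums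
  do not vanish.

  In part (i), with the zeros of \<open>p\<close> written \<open>- b - t\<^sub>i\<close>, the factor is \<open>g' + (c\<^bsub>k+1\<^esub> - c\<^sub>k) g\<close> for
  \<open>g z = c\<^sub>k z + (\<Sum>i. z/(z + t\<^sub>i))\<close>. Here the signs of single terms do not suffice; instead \<open>g'/g\<close> has
  non-real values on \<open>Re z > 0\<close>, \<open>Im z \<noteq> 0\<close>, because in \<open>Im (g' * cnj g)\<close>, expanded as a double sum,
  every pair of terms symmetric to each other has the right sign.
\<close>

section \<open>Sign estimates for imaginary parts in the right half-plane\<close>

lemma Im_of_real_mult: "Im (of_real a * z) = a * Im z"
  by simp

text \<open>Multiplying by conjugates makes both denominators real. As
  \<open>of_real s / (z + of_real s)\<^sup>2\<close> is the derivative of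
  \<open>z / (z + of_real s)\<close>, these are the terms of \<open>g' * cnj g\<close> that pair two
  fractions of \<open>g\<close>.\<close>

lemma Im_cross_term:
  fixes z :: complex and s t :: real
  assumes "Re z > 0" "s \<ge> 0" "t \<ge> 0"
  shows "Im (of_real s / (z + of_real s)\<^sup>2 * cnj (z / (z + of_real t))) =
    - (s * Im z * (2 * (Re z + s) * (Re z * (Re z + t) + (Im z)\<^sup>2) + ((Re z + s)\<^sup>2 - (Im z)\<^sup>2) * t))
      / (((Re z + s)\<^sup>2 + (Im z)\<^sup>2)\<^sup>2 * ((Re z + t)\<^sup>2 + (Im z)\<^sup>2))"
proof -
  define A where "A = z + of_real s"
  define B where "B = z + of_real t"
  define \<alpha> where "\<alpha> = (Re z + s)\<^sup>2 + (Im z)\<^sup>2"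
  define \<beta> where "\<beta> = (Re z + t)\<^sup>2 + (Im z)\<^sup>2"
  have pos: "\<alpha> > 0" "\<beta> > 0"
    using assms by (auto simp: \<alpha>_def \<beta>_def intro!: add_pos_nonneg)
  have a: "A * cnj A = of_real \<alpha>" and b: "B * cnj B = of_real \<beta>"
    by (simp_all add: A_def B_def \<alpha>_def \<beta>_def complex_eq_iff power2_eq_square)
  have nz: "A \<noteq> 0" "B \<noteq> 0" using a b pos by auto
  have "of_real s / A\<^sup>2 * cnj (z / B) = of_real s * (cnj z * (cnj A)\<^sup>2 * B) / ((A * cnj A)\<^sup>2 * (B * cnj B))"
    using nz by (simp add: divide_simps power2_eq_square)
  also have "\<dots> = of_real (s / (\<alpha>\<^sup>2 * \<beta>)) * (cnj z * (cnj A)\<^sup>2 * B)"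
    unfolding a b by simp
  finally have "Im (of_real s / A\<^sup>2 * cnj (z / B)) = s / (\<alpha>\<^sup>2 * \<beta>) * Im (cnj z * (cnj A)\<^sup>2 * B)"
    by (simp only: Im_of_real_mult)
  also have "Im (cnj z * (cnj A)\<^sup>2 * B) =
    - (Im z * (2 * (Re z + s) * (Re z * (Re z + t) + (Im z)\<^sup>2) + ((Re z + s)\<^sup>2 - (Im z)\<^sup>2) * t))"
    by (simp add: A_def B_def power2_eq_square algebra_simps)
  finally show ?thesis
    by (simp add: A_def B_def \<alpha>_def \<beta>_def)
qed

text \<open>A single cross term can have the wrong sign, because
  \<open>(Re z + s)\<^sup>2 - (Im z)\<^sup>2\<close> may be negative. Adding the term with
  \<open>s\<close> and \<open>t\<close> exchanged repairs this: over the common denominator the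
  numerator is minus a sum of nonnegative terms.\<close>

lemma Im_symmetrized_cross_term_le_0:
  fixes z :: complex and s t :: real
  assumes "Re z > 0" "s \<ge> 0" "t \<ge> 0"
  shows "Im z * Im (of_real s / (z + of_real s)\<^sup>2 * cnj (z / (z + of_real t)) +
           of_real t / (z + of_real t)\<^sup>2 * cnj (z / (z + of_real s))) \<le> 0"
proof -
  define u v where "u = Re z" and "v = Im z"
  define A B where "A = u + s" and "B = u + t"
  \<comment> \<open>\<open>X\<close> and \<open>Y\<close> are the bracketed factors in the
    numerators of \<open>Im_cross_term\<close> for the two orders of \<open>s\<close> and
    \<open>t\<close>.\<close>
  define X where "X = 2 * A * (u * B + v\<^sup>2) + (A\<^sup>2 - v\<^sup>2) * t"
  define Y where "Y = 2 * B * (u * A + v\<^sup>2) + (B\<^sup>2 - v\<^sup>2) * s"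
  have u: "u > 0" and st: "s \<ge> 0" "t \<ge> 0" and AB: "A > 0" "B > 0" "A \<ge> s" "B \<ge> t"
    using assms by (auto simp: u_def A_def B_def)
  define \<alpha> \<beta> where "\<alpha> = A\<^sup>2 + v\<^sup>2" and "\<beta> = B\<^sup>2 + v\<^sup>2"
  have pos: "\<alpha> > 0" "\<beta> > 0" using AB by (auto simp: \<alpha>_def \<beta>_def intro!: add_pos_nonneg)
  \<comment> \<open>The negative multiples of \<open>v\<^sup>2\<close> cancel in the symmetrised
    sum. What remains is \<open>- 2 * s * t * v ^ 4\<close>, which \<open>A \<ge> s\<close> and
    \<open>B \<ge> t\<close> absorb.\<close>
  have "s * \<beta> * X + t * \<alpha> * Y =
      2 * u * A * B * (s * \<beta> + t * \<alpha>) + 2 * s * t * A\<^sup>2 * B\<^sup>2 + 2 * v\<^sup>2 * (s * A * B\<^sup>2 + t * B * A\<^sup>2)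
      + 2 * v ^ 4 * (s * (A - s) + t * (B - t)) + 2 * v ^ 4 * (s\<^sup>2 + t\<^sup>2 - s * t)"
    by (simp add: X_def Y_def \<alpha>_def \<beta>_def power2_eq_square power4_eq_xxxx algebra_simps)
  also have "s\<^sup>2 + t\<^sup>2 - s * t = (s - t)\<^sup>2 + s * t"
    by (simp add: power2_eq_square algebra_simps)
  also have "2 * u * A * B * (s * \<beta> + t * \<alpha>) + 2 * s * t * A\<^sup>2 * B\<^sup>2 + 2 * v\<^sup>2 * (s * A * B\<^sup>2 + t * B * A\<^sup>2)
      + 2 * v ^ 4 * (s * (A - s) + t * (B - t)) + 2 * v ^ 4 * ((s - t)\<^sup>2 + s * t) \<ge> 0"
    using u st AB pos by (intro add_nonneg_nonneg mult_nonneg_nonneg) auto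
  finally have *: "s * \<beta> * X + t * \<alpha> * Y \<ge> 0" .
  have "v * Im (of_real s / (z + of_real s)\<^sup>2 * cnj (z / (z + of_real t)) +
           of_real t / (z + of_real t)\<^sup>2 * cnj (z / (z + of_real s))) =
     v * (- (s * v * X) / (\<alpha>\<^sup>2 * \<beta>) + - (t * v * Y) / (\<beta>\<^sup>2 * \<alpha>))"
    unfolding plus_complex.sel Im_cross_term[OF assms] Im_cross_term[OF assms(1,3,2)]
    by (simp add: u_def v_def A_def B_def X_def Y_def \<alpha>_def \<beta>_def)
  also have "\<dots> = - (v\<^sup>2 * (s * \<beta> * X + t * \<alpha> * Y) / (\<alpha>\<^sup>2 * \<beta>\<^sup>2))"
    using pos by (simp add: divide_simps) (simp add: power2_eq_square algebra_simps)
  also have "\<dots> \<le> 0" using * by simp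
  finally show ?thesis by (simp add: v_def)
qed

text \<open>Up to the factor \<open>c\<close>, these are the terms of \<open>g' * cnj g\<close> that
  pair the linear summand of \<open>g\<close> with one fraction.\<close>

lemma Im_linear_cross_term_le_0:
  fixes z :: complex and t :: real
  assumes "Re z > 0" "t \<ge> 0"
  shows "Im z * Im (cnj (z / (z + of_real t)) + of_real t / (z + of_real t)\<^sup>2 * cnj z) \<le> 0"
proof -
  define u v where "u = Re z" and "v = Im z"
  define A where "A = z + of_real t"
  define \<alpha> where "\<alpha> = (u + t)\<^sup>2 + v\<^sup>2"
  have u: "u > 0" using assms by (simp add: u_def)
  have pos: "\<alpha> > 0"
    using assms by (auto simp: \<alpha>_def u_def intro!: add_pos_nonneg)
  have a: "A * cnj A = of_real \<alpha>"
    by (simp add: A_def \<alpha>_def u_def v_def complex_eq_iff power2_eq_square)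
  have nz: "A \<noteq> 0" using a pos by auto
  have "cnj (z / A) + of_real t / A\<^sup>2 * cnj z =
     (cnj z * A * (A * cnj A) + of_real t * (cnj z * (cnj A)\<^sup>2)) / (A * cnj A)\<^sup>2"
    using nz by (simp add: divide_simps power2_eq_square) (simp add: algebra_simps)
  also have "\<dots> = of_real (1 / \<alpha>\<^sup>2) * (of_real \<alpha> * (cnj z * A) + of_real t * (cnj z * (cnj A)\<^sup>2))"
    unfolding a by simp
  finally have "Im (cnj (z / A) + of_real t / A\<^sup>2 * cnj z) =
      1 / \<alpha>\<^sup>2 * (\<alpha> * Im (cnj z * A) + t * Im (cnj z * (cnj A)\<^sup>2))"
    by (simp only: Im_of_real_mult plus_complex.sel)
  also have "\<alpha> * Im (cnj z * A) + t * Im (cnj z * (cnj A)\<^sup>2) = - (v * (2 * t * (u + t) * (2 * u + t)))"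
    by (simp add: A_def \<alpha>_def u_def v_def power2_eq_square algebra_simps)
  finally have "v * Im (cnj (z / A) + of_real t / A\<^sup>2 * cnj z) =
      - (v\<^sup>2 * (2 * t * (u + t) * (2 * u + t)) / \<alpha>\<^sup>2)"
    by (simp add: power2_eq_square)
  also have "\<dots> \<le> 0" using u assms by simp
  finally show ?thesis by (simp add: v_def A_def)
qed

text \<open>If \<open>w\<close> were a real multiple of \<open>z\<close>, then
  \<open>w * cnj z\<close> would be real.\<close>

lemma add_real_multiple_nonzero:
  fixes w z :: complex
  assumes "Im (w * cnj z) \<noteq> 0"
  shows "w + of_real d * z \<noteq> 0"
proof
  assume "w + of_real d * z = 0"
  then have "w = - (of_real d * z)" by (simp add: eq_neg_iff_add_eq_0)
  with assms show False by simp
qed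

text \<open>This is \<open>g' z + \<delta> g z \<noteq> 0\<close> for \<open>g z = c z + (\<Sum>i\<in>I. z/(z + t i))\<close>.\<close>
lemma bernstein_deriv_plus_multiple_nonzero:
  fixes z :: complex and t :: "'i \<Rightarrow> real" and c \<delta> :: real
  assumes z: "Re z > 0" and t: "\<And>i. i \<in> I \<Longrightarrow> t i \<ge> 0" and c: "c > 0" and \<delta>: "\<delta> \<ge> 0"
  shows "of_real c + (\<Sum>i\<in>I. of_real (t i) / (z + of_real (t i))\<^sup>2)
    + of_real \<delta> * (of_real c * z + (\<Sum>i\<in>I. z / (z + of_real (t i)))) \<noteq> 0" (is "?g' + of_real \<delta> * ?g \<noteq> 0")
proof (cases "Im z = 0")
  case True
  then obtain x where x: "z = of_real x" "x > 0"
    using z by (metis complex_is_Real_iff Reals_cases Re_complex_of_real)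
  \<comment> \<open>On the positive real axis imaginary parts say nothing, but there no summand is
    negative and \<open>c\<close> is positive.\<close>
  have "?g' + of_real \<delta> * ?g = of_real (c + (\<Sum>i\<in>I. t i / (x + t i)\<^sup>2) + \<delta> * (c * x + (\<Sum>i\<in>I. x / (x + t i))))"
    by (simp add: x)
  also have "\<dots> \<noteq> 0"
  proof -
    have "(\<Sum>i\<in>I. t i / (x + t i)\<^sup>2) \<ge> 0" "\<delta> * (c * x + (\<Sum>i\<in>I. x / (x + t i))) \<ge> 0"
      using t x c \<delta> by (auto intro!: sum_nonneg add_nonneg_nonneg mult_nonneg_nonneg)
    then show ?thesis using c unfolding of_real_eq_0_iff by linarith
  qed
  finally show ?thesis .
next
  case False
  define H where "H = (\<Sum>i\<in>I. of_real (t i) / (z + of_real (t i))\<^sup>2)"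
  define G where "G = (\<Sum>i\<in>I. z / (z + of_real (t i)))"
  have HG: "Im z * Im (H * cnj G) \<le> 0"
  proof -
    have "H * cnj G = (\<Sum>i\<in>I. \<Sum>j\<in>I. of_real (t i) / (z + of_real (t i))\<^sup>2 * cnj (z / (z + of_real (t j))))"
      (is "_ = (\<Sum>i\<in>I. \<Sum>j\<in>I. ?f i j)")
      unfolding H_def G_def cnj_sum sum_product ..
    \<comment> \<open>Exchanging the indices and adding makes every summand, diagonal ones included,
      an instance of the symmetrised estimate.\<close>
    moreover have "\<dots> = (\<Sum>i\<in>I. \<Sum>j\<in>I. ?f j i)" by (rule sum.swap)
    ultimately have "2 * (H * cnj G) = (\<Sum>i\<in>I. \<Sum>j\<in>I. ?f i j + ?f j i)"
      by (simp only: sum.distrib mult_2)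
    then have "Im z * Im (2 * (H * cnj G)) = (\<Sum>i\<in>I. \<Sum>j\<in>I. Im z * Im (?f i j + ?f j i))"
      by (simp only: Im_sum sum_distrib_left)
    also have "\<dots> \<le> 0"
      using Im_symmetrized_cross_term_le_0[OF z] t by (intro sum_nonpos) blast
    also have "Im (2 * (H * cnj G)) = 2 * Im (H * cnj G)"
      by simp
    finally show ?thesis by linarith
  qed
  have cHG: "Im z * Im (cnj G + H * cnj z) \<le> 0"
  proof -
    have "Im z * Im (cnj G + H * cnj z) =
       (\<Sum>i\<in>I. Im z * Im (cnj (z / (z + of_real (t i))) + of_real (t i) / (z + of_real (t i))\<^sup>2 * cnj z))"
      unfolding H_def G_def cnj_sum sum_distrib_right
      by (simp only: Im_sum sum_distrib_left flip: sum.distrib)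
    also have "\<dots> \<le> 0"
      using Im_linear_cross_term_le_0[OF z] t by (intro sum_nonpos) blast
    finally show ?thesis .
  qed
  \<comment> \<open>Here \<open>?g'\<close> is \<open>c + H\<close> and \<open>?g\<close> is
    \<open>c * z + G\<close>. The first summand supplies the strict inequality; the other two have
    been shown to have the right weak sign.\<close>
  have "?g' * cnj ?g = of_real (c\<^sup>2) * cnj z + of_real c * (cnj G + H * cnj z) + H * cnj G"
    unfolding H_def[symmetric] G_def[symmetric] by (simp add: power2_eq_square algebra_simps)
  then have "Im z * Im (?g' * cnj ?g) =
      - (c\<^sup>2 * (Im z)\<^sup>2) + c * (Im z * Im (cnj G + H * cnj z)) + Im z * Im (H * cnj G)"
    by (simp only: plus_complex.sel Im_of_real_mult) (simp add: power2_eq_square algebra_simps)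
  moreover have "c\<^sup>2 * (Im z)\<^sup>2 > 0" using c False by simp
  moreover have "c * (Im z * Im (cnj G + H * cnj z)) \<le> 0"
    using c cHG by (simp add: mult_nonneg_nonpos)
  ultimately have "Im z * Im (?g' * cnj ?g) < 0" using HG by linarith
  then have "Im (?g' * cnj ?g) \<noteq> 0" by (metis less_irrefl mult_zero_right)
  then show ?thesis by (rule add_real_multiple_nonzero)
qed

text \<open>If \<open>Re s > 0\<close>, the imaginary part of \<open>1 / s\<^sup>2\<close> has the
  sign of \<open>- Im s\<close>, so off the real axis the terms cannot cancel; on it, they are
  nonnegative. Part (ii) uses unit weights and \<open>c = a\<close>, part (iii) the weights
  \<open>(t i)\<^sup>2\<close> and \<open>c = 0\<close>.\<close>

lemma sum_weighted_inverse_square_nonzero: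
  fixes z :: complex and t w :: "'i \<Rightarrow> real" and c :: real
  assumes fin: "finite I" and t: "\<And>i. i \<in> I \<Longrightarrow> Re z + t i > 0" and w: "\<And>i. i \<in> I \<Longrightarrow> w i \<ge> 0"
    and c: "c \<ge> 0" and pos: "c > 0 \<or> (\<exists>i\<in>I. w i > 0)"
  shows "of_real c + (\<Sum>i\<in>I. of_real (w i) / (z + of_real (t i))\<^sup>2) \<noteq> 0" (is "?S \<noteq> 0")
proof (cases "\<exists>i\<in>I. w i > 0")
  case False
  then have "\<And>i. i \<in> I \<Longrightarrow> w i = 0" using w by force
  then have "?S = of_real c" by simp
  then show ?thesis using False pos by simp
next
  case True
  then obtain j where j: "j \<in> I" "w j > 0" by blast
  show ?thesis
  proof (cases "Im z = 0")
    case True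
    then obtain x where x: "z = of_real x"
      by (metis complex_is_Real_iff Reals_cases)
    have "?S = of_real (c + (\<Sum>i\<in>I. w i / (x + t i)\<^sup>2))"
      by (simp add: x)
    moreover have "(\<Sum>i\<in>I. w i / (x + t i)\<^sup>2) > 0"
      using j w t[of j] x by (intro sum_pos2[OF fin, of j]) auto
    then have "c + (\<Sum>i\<in>I. w i / (x + t i)\<^sup>2) \<noteq> 0" using c by linarith
    ultimately show ?thesis by (simp only: of_real_eq_0_iff not_False_eq_True)
  next
    case False
    let ?N = "\<lambda>i. cmod (z + of_real (t i))"
    have im: "Im (of_real (w i) / (z + of_real (t i))\<^sup>2) =
        - (Im z * (2 * w i * (Re z + t i) / ?N i ^ 4))" if "i \<in> I" for i
    proof -
      define s where "s = z + of_real (t i)"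
      have "s \<noteq> 0" using t[OF that] by (auto simp: s_def complex_eq_iff)
      then have "of_real (w i) / s\<^sup>2 = of_real (w i) * (cnj s)\<^sup>2 / (s * cnj s)\<^sup>2"
        by (simp add: divide_simps power2_eq_square)
      also have "\<dots> = of_real (w i / cmod s ^ 4) * (cnj s)\<^sup>2"
        by (simp flip: complex_norm_square)
      finally have "Im (of_real (w i) / s\<^sup>2) = w i / cmod s ^ 4 * Im ((cnj s)\<^sup>2)"
        by (simp only: Im_of_real_mult)
      then show ?thesis by (simp add: s_def power2_eq_square)
    qed
    have "(\<Sum>i\<in>I. 2 * w i * (Re z + t i) / ?N i ^ 4) > 0"
    proof (rule sum_pos2[OF fin j(1)])
      have "z + of_real (t j) \<noteq> 0" using t[OF j(1)] by (auto simp: complex_eq_iff)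
      then show "0 < 2 * w j * (Re z + t j) / ?N j ^ 4"
        using j t[OF j(1)] by simp
    qed (use w t in \<open>force intro!: divide_nonneg_nonneg mult_nonneg_nonneg intro: less_imp_le\<close>)
    moreover have "Im ?S = - (Im z * (\<Sum>i\<in>I. 2 * w i * (Re z + t i) / ?N i ^ 4))"
      by (simp add: im sum_negf sum_distrib_left)
    ultimately have "Im ?S \<noteq> 0" using False by simp
    then show ?thesis by (metis zero_complex.sel(2))
  qed
qed

section \<open>Passage from real to complex polynomials\<close>

lemma complex_poly_add: "complex_poly (p + q) = complex_poly p + complex_poly q"
  by (rule poly_eqI) (simp add: coeff_map_poly)

lemma complex_poly_diff: "complex_poly (p - q) = complex_poly p - complex_poly q"
  by (rule poly_eqI) (simp add: coeff_map_poly)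

lemma complex_poly_mult: "complex_poly (p * q) = complex_poly p * complex_poly q"
  by (rule poly_eqI) (simp add: coeff_map_poly coeff_mult)

lemma complex_poly_power: "complex_poly (p ^ n) = complex_poly p ^ n"
  by (induction n) (simp_all add: complex_poly_mult)

lemma complex_poly_smult: "complex_poly (smult c p) = smult (of_real c) (complex_poly p)"
  by (rule poly_eqI) (simp add: coeff_map_poly)

lemma complex_poly_pderiv: "complex_poly (pderiv p) = pderiv (complex_poly p)"
  by (rule poly_eqI) (simp add: coeff_map_poly coeff_pderiv)

lemma complex_poly_pCons: "complex_poly (pCons c p) = pCons (of_real c) (complex_poly p)"
  by (simp add: map_poly_pCons)

lemma complex_poly_prod: "complex_poly (\<Prod>i\<in>I. f i) = (\<Prod>i\<in>I. complex_poly (f i))"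
  by (induction I rule: infinite_finite_induct) (simp_all add: complex_poly_mult)

lemmas complex_poly_hom = complex_poly_add complex_poly_diff complex_poly_mult complex_poly_power
  complex_poly_smult complex_poly_pderiv complex_poly_pCons complex_poly_prod

lemma poly_complex_poly_of_real [simp]: "poly (complex_poly p) (of_real x) = of_real (poly p x)"
  by (induction p) (simp_all add: complex_poly_pCons)

lemma complex_poly_pcompose: "complex_poly (pcompose p q) = pcompose (complex_poly p) (complex_poly q)"
  by (induction p) (simp_all add: pcompose_pCons complex_poly_hom)

lemma inj_complex_poly: "complex_poly p = complex_poly q \<Longrightarrow> p = q"
  by (metis coeff_map_poly of_real_0 of_real_eq_iff poly_eqI)

section \<open>Products of linear factors and their derivatives\<close>

text \<open>The zeros are listed with multiplicity by an index function, which allows induction on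
  \<open>n\<close>; the general ring serves both real and complex products.\<close>

definition linear_product :: "nat \<Rightarrow> (nat \<Rightarrow> 'a::comm_ring_1) \<Rightarrow> 'a poly" where
  "linear_product n r = (\<Prod>i<n. [:- r i, 1:])"

lemma linear_product_0 [simp]: "linear_product 0 r = 1"
  by (simp add: linear_product_def)

lemma linear_product_Suc: "linear_product (Suc n) r = linear_product n r * [:- r n, 1:]"
  by (simp add: linear_product_def)

lemma poly_linear_product_Suc [simp]:
  "poly (linear_product (Suc n) r) x = poly (linear_product n r) x * (x - r n)"
  by (simp add: linear_product_Suc algebra_simps)

lemma poly_pderiv_linear_product_Suc [simp]:
  fixes r :: "nat \<Rightarrow> 'a::idom"
  shows "poly (pderiv (linear_product (Suc n) r)) x =
    poly (pderiv (linear_product n r)) x * (x - r n) + poly (linear_product n r) x"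
  unfolding linear_product_Suc pderiv_mult by (simp add: pderiv_pCons algebra_simps)

lemma poly_pderiv2_linear_product_Suc [simp]:
  fixes r :: "nat \<Rightarrow> 'a::idom"
  shows "poly (pderiv (pderiv (linear_product (Suc n) r))) x =
    poly (pderiv (pderiv (linear_product n r))) x * (x - r n) + 2 * poly (pderiv (linear_product n r)) x"
  unfolding linear_product_Suc pderiv_mult pderiv_add by (simp add: pderiv_mult pderiv_pCons algebra_simps)

lemma poly_linear_product_eq_0_iff:
  fixes z :: "'a::idom"
  shows "poly (linear_product n r) z = 0 \<longleftrightarrow> (\<exists>i<n. z = r i)"
  by (auto simp: linear_product_def poly_prod)

lemma poly_pderiv_linear_product:
  fixes z :: "'a::field"
  assumes "poly (linear_product n r) z \<noteq> 0"
  shows "poly (pderiv (linear_product n r)) z = poly (linear_product n r) z * (\<Sum>i<n. 1 / (z - r i))"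
  using assms by (induction n) (auto simp: field_simps)

text \<open>In terms of the logarithmic derivative \<open>L\<close>, differentiating
  \<open>p' = p * L\<close> gives \<open>p'' = p * (L\<^sup>2 + L')\<close>, and
  \<open>L' = - M\<close>.\<close>

lemma poly_pderiv2_linear_product:
  fixes z :: "'a::field"
  assumes "poly (linear_product n r) z \<noteq> 0"
  shows "poly (pderiv (pderiv (linear_product n r))) z =
      poly (linear_product n r) z * ((\<Sum>i<n. 1 / (z - r i))\<^sup>2 - (\<Sum>i<n. 1 / (z - r i)\<^sup>2))"
  using assms
proof (induction n)
  case (Suc n)
  define q where "q = poly (linear_product n r) z"
  define L where "L = (\<Sum>i<n. 1 / (z - r i))"
  define M where "M = (\<Sum>i<n. 1 / (z - r i)\<^sup>2)"
  define l where "l = z - r n"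
  have nz: "q \<noteq> 0" "l \<noteq> 0" using Suc.prems by (auto simp: q_def l_def)
  have "poly (pderiv (pderiv (linear_product (Suc n) r))) z = q * (L\<^sup>2 - M) * l + 2 * (q * L)"
    using nz Suc.IH by (simp add: poly_pderiv_linear_product q_def L_def M_def l_def)
  also have "\<dots> = q * l * ((L + 1 / l)\<^sup>2 - (M + 1 / l\<^sup>2))"
    using nz by (simp add: field_simps power2_eq_square)
  finally show ?case
    by (simp add: q_def L_def M_def l_def)
qed simp

text \<open>The polynomial splits over the complex numbers; as its zeros are real, the factorization
  is the image of a real one, and the embedding is injective.\<close>

lemma real_rooted_splits:
  fixes p :: "real poly"
  assumes "p \<noteq> 0" and real: "\<And>z. poly (complex_poly p) z = 0 \<Longrightarrow> z \<in> \<real>"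
  obtains r where "p = smult (lead_coeff p) (linear_product (degree p) r)"
proof -
  let ?q = "complex_poly p"
  have q: "?q \<noteq> 0" "degree ?q = degree p" "lead_coeff ?q = of_real (lead_coeff p)"
    using assms(1) by (simp_all add: map_poly_eq_0_iff degree_map_poly coeff_map_poly)
  from alg_closed_imp_factorization[OF q(1)] obtain A where
    A: "size A = degree p" "?q = smult (of_real (lead_coeff p)) (\<Prod>x\<in>#A. [:-x, 1:])"
    using q(2,3) by auto
  obtain xs where xs: "A = mset xs" using ex_mset by metis
  have len: "length xs = degree p" using A(1) xs by simp
  have "(\<Prod>x\<in>#A. [:-x, 1:]) = (\<Prod>x\<leftarrow>xs. [:-x, 1:])"
    by (simp add: xs flip: prod_mset_prod_list)
  also have "\<dots> = (\<Prod>i<degree p. [:- (xs ! i), 1:])"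
    by (simp add: prod.list_conv_set_nth len atLeast0LessThan)
  finally have prod: "(\<Prod>x\<in>#A. [:-x, 1:]) = (\<Prod>i<degree p. [:- (xs ! i), 1:])" .
  have "complex_of_real (Re (xs ! i)) = xs ! i" if "i < degree p" for i
  proof -
    have "poly ?q (xs ! i) = 0"
      using that unfolding A(2) prod by (auto simp: poly_prod)
    then show ?thesis using real by (simp add: of_real_Re)
  qed
  then have "(\<Prod>i<degree p. [:- (xs ! i), 1:]) = complex_poly (linear_product (degree p) (\<lambda>i. Re (xs ! i)))"
    by (simp add: linear_product_def complex_poly_hom)
  then have "?q = complex_poly (smult (lead_coeff p) (linear_product (degree p) (\<lambda>i. Re (xs ! i))))"
    using A(2) prod by (simp add: complex_poly_smult)
  then show thesis using that inj_complex_poly by blast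
qed

lemma complex_poly_linear_product: "complex_poly (linear_product n r) = linear_product n (\<lambda>i. of_real (r i))"
  by (simp add: linear_product_def complex_poly_hom)

lemma linear_product_right_of_roots:
  fixes x :: "'a::linordered_idom"
  assumes "\<And>i. i < n \<Longrightarrow> r i \<le> x"
  shows "poly (linear_product n r) x \<ge> 0"
  using assms by (induction n) auto

text \<open>The product rule yields only products of nonnegative factors. The inequality is weak
  because \<open>x\<close> will be the largest zero itself.\<close>

lemma pderiv_linear_product_right_of_roots:
  fixes x :: "'a::linordered_idom"
  assumes "\<And>i. i < n \<Longrightarrow> r i \<le> x"
  shows "poly (pderiv (linear_product n r)) x \<ge> 0"
  using assms by (induction n) (auto intro!: add_nonneg_nonneg linear_product_right_of_roots)

text \<open>The reflection of \<open>x\<close> to \<open>- x\<close> carries sign facts from the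
  right of all zeros to the left.\<close>

lemma linear_product_reflect:
  fixes r :: "nat \<Rightarrow> 'a::idom"
  shows "poly (linear_product n (\<lambda>i. - r i)) (- x) = (- 1) ^ n * poly (linear_product n r) x"
  by (induction n) (simp_all add: algebra_simps)

lemma pderiv_linear_product_reflect:
  fixes r :: "nat \<Rightarrow> 'a::idom"
  shows "poly (pderiv (linear_product n (\<lambda>i. - r i))) (- x) = - ((- 1) ^ n * poly (pderiv (linear_product n r)) x)"
  by (induction n) (simp_all add: linear_product_reflect algebra_simps)

section \<open>Real-rooted polynomials and their logarithmic derivatives\<close>

text \<open>The number of factors is a parameter of its own, so that instances can use an index such
  as \<open>Suc k\<close> in place of a degree.\<close>

locale real_splitting =
  fixes p :: "real poly" and n :: nat and r :: "nat \<Rightarrow> real"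
  assumes nonzero: "p \<noteq> 0" and splits: "p = smult (lead_coeff p) (linear_product n r)"
begin

lemma complex_splits:
  "complex_poly p = smult (of_real (lead_coeff p)) (linear_product n (\<lambda>i. of_real (r i)))"
  by (subst splits) (simp only: complex_poly_smult complex_poly_linear_product)

lemma complex_root_iff: "poly (complex_poly p) z = 0 \<longleftrightarrow> (\<exists>i<n. z = of_real (r i))"
  using nonzero by (subst complex_splits) (simp add: poly_linear_product_eq_0_iff)

lemma root_iff: "poly p x = 0 \<longleftrightarrow> (\<exists>i<n. x = r i)"
  using nonzero by (subst splits) (simp add: poly_linear_product_eq_0_iff)

lemma root_nth: "i < n \<Longrightarrow> poly p (r i) = 0"
  using root_iff by blast

lemma poly_pderiv_complex:
  assumes "poly (complex_poly p) z \<noteq> 0"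
  shows "poly (pderiv (complex_poly p)) z = poly (complex_poly p) z * (\<Sum>i<n. 1 / (z - of_real (r i)))"
proof -
  have "poly (linear_product n (\<lambda>i. complex_of_real (r i))) z \<noteq> 0"
    using assms unfolding complex_splits by simp
  from poly_pderiv_linear_product[OF this] show ?thesis
    unfolding complex_splits pderiv_smult poly_smult by simp
qed

lemma poly_pderiv2_complex:
  assumes "poly (complex_poly p) z \<noteq> 0"
  shows "poly (pderiv (pderiv (complex_poly p))) z = poly (complex_poly p) z *
    ((\<Sum>i<n. 1 / (z - of_real (r i)))\<^sup>2 - (\<Sum>i<n. 1 / (z - of_real (r i))\<^sup>2))"
proof -
  have "poly (linear_product n (\<lambda>i. complex_of_real (r i))) z \<noteq> 0"
    using assms unfolding complex_splits by simp
  from poly_pderiv2_linear_product[OF this] show ?thesis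
    unfolding complex_splits pderiv_smult poly_smult by simp
qed

end

lemma real_rooted_splitting:
  assumes "p \<noteq> 0" "\<And>z. poly (complex_poly p) z = 0 \<Longrightarrow> z \<in> \<real>"
  obtains r where "real_splitting p (degree p) r"
  using real_rooted_splits[OF assms] assms(1) unfolding real_splitting_def by metis

lemma Im_sum_inverse_diff_of_real:
  "Im (\<Sum>i\<in>I. 1 / (z - complex_of_real (r i))) = - Im z * (\<Sum>i\<in>I. 1 / (cmod (z - of_real (r i)))\<^sup>2)"
  by (simp add: Im_divide cmod_power2 sum_distrib_left sum_negf[symmetric])

section \<open>Part (i): zeros under \<open>D + c\<close> and the Turan expression\<close>

text \<open>Off the zeros of \<open>p\<close> the equation says \<open>L = - c\<close>. A non-real
  \<open>z\<close> is impossible since the imaginary parts of all \<open>1/(z - r i)\<close> have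
  one sign; a real \<open>z\<close> beyond \<open>\<beta>\<close> is impossible since then
  \<open>L\<close> is nonnegative.\<close>

lemma roots_pderiv_plus_multiple:
  fixes p :: "real poly"
  assumes p: "p \<noteq> 0" and c: "c > 0"
    and roots: "\<And>z. poly (complex_poly p) z = 0 \<Longrightarrow> z \<in> \<real> \<and> Re z \<le> \<beta>"
    and z: "poly (complex_poly (pderiv p + smult c p)) z = 0"
  shows "z \<in> \<real> \<and> Re z \<le> \<beta>"
proof (cases "poly (complex_poly p) z = 0")
  case True
  then show ?thesis by (rule roots)
next
  case False
  obtain r where "real_splitting p (degree p) r"
    using real_rooted_splitting p roots by metis
  then interpret real_splitting p "degree p" r .
  define L where "L = (\<Sum>i<degree p. 1 / (z - of_real (r i)))"
  have "poly (complex_poly p) z * (L + of_real c) = 0"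
    using z poly_pderiv_complex[OF False] by (simp add: complex_poly_hom L_def algebra_simps)
  then have L: "L = - of_real c" using False by (simp add: eq_neg_iff_add_eq_0)
  have r: "r i \<le> \<beta>" if "i < degree p" for i
    using roots[of "of_real (r i)"] root_nth that by auto
  \<comment> \<open>For constant \<open>p\<close> the sum \<open>L\<close> would be empty, hence
    zero. A summand is needed for strict positivity below.\<close>
  have "degree p > 0" using L c by (auto simp: L_def intro!: Nat.gr0I)
  have "Im z = 0"
  proof (rule ccontr)
    assume v: "Im z \<noteq> 0"
    have "(\<Sum>i<degree p. 1 / (cmod (z - of_real (r i)))\<^sup>2) > 0"
      using v \<open>degree p > 0\<close> by (intro sum_pos) (auto simp: complex_eq_iff)
    moreover have "Im L = 0" by (simp add: L)
    ultimately show False using v unfolding L_def Im_sum_inverse_diff_of_real by simp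
  qed
  then have zR: "z = of_real (Re z)" by (simp add: complex_eq_iff)
  moreover have "Re z \<le> \<beta>"
  proof (rule ccontr)
    assume "\<not> Re z \<le> \<beta>"
    then have "(\<Sum>i<degree p. 1 / (Re z - r i)) \<ge> 0" using r by (force intro!: sum_nonneg)
    moreover have "L = of_real (\<Sum>i<degree p. 1 / (Re z - r i))"
      unfolding L_def by (subst zR) simp
    ultimately show False using L c
      by (metis Re_complex_of_real uminus_complex.sel(1) neg_0_le_iff_le not_less)
  qed
  ultimately show ?thesis by (metis Reals_of_real)
qed

text \<open>By induction all zeros of every \<open>P k\<close> are real and at most
  \<open>- b\<close>: \<open>D + c k\<close> preserves this, and the factor \<open>x + b\<close>
  adds only the zero \<open>- b\<close>. Then everything is expressed through \<open>P k\<close> at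
  the shifted point.\<close>

lemma turan_multiplier_differentiation:
  fixes P :: "nat \<Rightarrow> real poly" and a b :: real and c :: "nat \<Rightarrow> real"
  assumes nz: "\<And>k. P k \<noteq> 0" and const: "degree (P 0) = 0"
    and c: "\<And>k. c k \<le> c (Suc k)" "\<And>k. c k > 0" and a: "a \<noteq> 0"
    and rec: "\<And>k. P (Suc k) = smult a ([:b, 1:] * (pderiv (P k) + smult (c k) (P k)))"
    and z: "Re z > 0"
  shows "poly (complex_poly (turan P k)) (z - of_real b) \<noteq> 0"
proof -
  have roots: "w \<in> \<real> \<and> Re w \<le> - b" if "poly (complex_poly (P k)) w = 0" for k w
    using that
  proof (induction k arbitrary: w)
    case 0
    from const obtain d where "P 0 = [:d:]" by (rule degree_eq_zeroE)
    then show ?case using 0 nz[of 0] by (simp add: complex_poly_pCons)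
  next
    case (Suc k)
    have "poly (complex_poly (P (Suc k))) w = of_real a * ((w + of_real b) *
        poly (complex_poly (pderiv (P k) + smult (c k) (P k))) w)"
      unfolding rec complex_poly_smult complex_poly_mult complex_poly_pCons
      by (simp add: algebra_simps)
    with Suc.prems a have "w + of_real b = 0 \<or> poly (complex_poly (pderiv (P k) + smult (c k) (P k))) w = 0"
      by simp
    then show ?case
    proof
      assume "w + of_real b = 0"
      then have "w = of_real (- b)" by (simp add: eq_neg_iff_add_eq_0)
      then show ?thesis by simp
    next
      assume "poly (complex_poly (pderiv (P k) + smult (c k) (P k))) w = 0"
      then show ?thesis using roots_pderiv_plus_multiple[OF nz c(2) Suc.IH] by blast
    qed
  qed
  let ?n = "degree (P k)"
  obtain r where "real_splitting (P k) ?n r"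
    using real_rooted_splitting nz roots by metis
  then interpret real_splitting "P k" ?n r .
  \<comment> \<open>At \<open>y\<close> the factor \<open>x + b\<close> has the value
    \<open>z\<close>, and the differences from the zeros become \<open>z + t i\<close> with
    \<open>t i \<ge> 0\<close>.\<close>
  define y where "y = z - of_real b"
  define t where "t = (\<lambda>i. - b - r i)"
  have t: "t i \<ge> 0" if "i < ?n" for i
    using roots[of k "of_real (r i)"] root_nth that by (auto simp: t_def)
  have ydiff: "y - of_real (r i) = z + of_real (t i)" for i by (simp add: y_def t_def)
  have zt: "z + of_real (t i) \<noteq> 0" if "i < ?n" for i
    using z t[OF that] by (auto simp: complex_eq_iff)
  define p where "p = poly (complex_poly (P k)) y"
  have p: "p \<noteq> 0" using roots[of k y] z by (auto simp: p_def y_def)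
  define L where "L = (\<Sum>i<?n. 1 / (z + of_real (t i)))"
  define M where "M = (\<Sum>i<?n. 1 / (z + of_real (t i))\<^sup>2)"
  have p': "poly (pderiv (complex_poly (P k))) y = p * L"
    using poly_pderiv_complex[of y] p by (simp add: p_def L_def ydiff)
  have p'': "poly (pderiv (pderiv (complex_poly (P k)))) y = p * (L\<^sup>2 - M)"
    using poly_pderiv2_complex[of y] p by (simp add: p_def L_def M_def ydiff)
  define ca cc cd where "ca = complex_of_real a" and "cc = complex_of_real (c k)"
    and "cd = complex_of_real (c (Suc k))"
  have C1: "complex_poly (P (Suc k)) =
      smult ca ([:of_real b, 1:] * (pderiv (complex_poly (P k)) + smult cc (complex_poly (P k))))"
    unfolding rec by (simp add: complex_poly_hom ca_def cc_def)
  have C2: "complex_poly (P (Suc (Suc k))) =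
      smult ca ([:of_real b, 1:] * (pderiv (complex_poly (P (Suc k))) + smult cd (complex_poly (P (Suc k)))))"
    unfolding rec[of "Suc k"] by (simp add: complex_poly_hom ca_def cd_def)
  have e1: "poly (complex_poly (P (Suc k))) y = ca * z * p * (L + cc)"
    unfolding C1 by (simp add: p' p_def[symmetric] y_def[symmetric]) (simp add: y_def algebra_simps)
  have e1': "poly (pderiv (complex_poly (P (Suc k)))) y = ca * p * (L + cc + z * (L\<^sup>2 - M + cc * L))"
    unfolding C1 pderiv_smult pderiv_mult
    by (simp add: pderiv_add pderiv_smult pderiv_pCons p' p'' p_def[symmetric]) (simp add: y_def algebra_simps)
  have e2: "poly (complex_poly (P (Suc (Suc k)))) y = ca * z *
      (ca * p * (L + cc + z * (L\<^sup>2 - M + cc * L)) + cd * (ca * z * p * (L + cc)))"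
    unfolding C2 by (simp add: e1 e1') (simp add: y_def algebra_simps)
  \<comment> \<open>The terms in \<open>L\<^sup>2\<close> cancel. The bracket is
    \<open>g' + (cd - cc) * g\<close> for \<open>g = cc * z + z * L\<close>, as the next two
    rewritings show.\<close>
  have "poly (complex_poly (turan P k)) y =
      - (ca\<^sup>2 * z * p\<^sup>2 * ((cc + (L - z * M)) + (cd - cc) * (cc * z + z * L)))"
    unfolding turan_def complex_poly_hom
    by (simp add: e1 e2 p_def[symmetric]) (simp add: algebra_simps power2_eq_square)
  also have "L - z * M = (\<Sum>i<?n. of_real (t i) / (z + of_real (t i))\<^sup>2)"
    unfolding L_def M_def sum_distrib_left sum_subtractf[symmetric]
    by (rule sum.cong) (use zt in \<open>auto simp: divide_simps power2_eq_square\<close>)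
  also have "z * L = (\<Sum>i<?n. z / (z + of_real (t i)))"
    by (simp add: L_def sum_distrib_left)
  also have "cd - cc = of_real (c (Suc k) - c k)" by (simp add: cd_def cc_def)
  finally have "poly (complex_poly (turan P k)) y = - (ca\<^sup>2 * z * p\<^sup>2 *
     (cc + (\<Sum>i<?n. of_real (t i) / (z + of_real (t i))\<^sup>2) +
      of_real (c (Suc k) - c k) * (cc * z + (\<Sum>i<?n. z / (z + of_real (t i))))))" .
  moreover have "cc + (\<Sum>i<?n. of_real (t i) / (z + of_real (t i))\<^sup>2) +
      of_real (c (Suc k) - c k) * (cc * z + (\<Sum>i<?n. z / (z + of_real (t i)))) \<noteq> 0"
    unfolding cc_def using c z t by (intro bernstein_deriv_plus_multiple_nonzero) auto
  moreover have "ca \<noteq> 0" "z \<noteq> 0" using a z by (auto simp: ca_def)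
  ultimately show ?thesis using p by (simp add: y_def)
qed

section \<open>Part (iii): the recurrence with \<open>x D - k\<close>\<close>

text \<open>The recurrence lowers the index, so \<open>P (k + 1)\<close> and \<open>P k\<close> are
  both expressed through \<open>P (k + 2)\<close> and its logarithmic derivative.\<close>

lemma turan_euler_operator:
  fixes P :: "nat \<Rightarrow> real poly"
  assumes deg: "\<And>k. P k \<noteq> 0" "\<And>k. degree (P k) = k"
    and rec: "\<And>k. [:0, 1:] * pderiv (P (Suc k)) - smult (real (Suc k)) (P (Suc k)) = P k"
    and roots: "\<And>k z. poly (complex_poly (P k)) z = 0 \<Longrightarrow> z \<in> \<real> \<and> Re z \<le> 0"
    and z: "Re z > 0"
  shows "poly (complex_poly (turan P k)) z \<noteq> 0"
proof -
  let ?q = "P (Suc (Suc k))" and ?n = "Suc (Suc k)"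
  obtain r where "real_splitting ?q ?n r"
    using real_rooted_splitting deg roots by metis
  then interpret real_splitting ?q ?n r .
  have nonroot: "poly (complex_poly (P j)) z \<noteq> 0" for j using roots[of j z] z by auto
  define t where "t = (\<lambda>i. - r i)"
  have t: "t i \<ge> 0" if "i < ?n" for i
    using roots[of ?n "of_real (r i)"] root_nth that by (auto simp: t_def)
  have zdiff: "z - of_real (r i) = z + of_real (t i)" for i by (simp add: t_def)
  have zt: "z + of_real (t i) \<noteq> 0" if "i < ?n" for i
    using z t[OF that] by (auto simp: complex_eq_iff)
  define q where "q = poly (complex_poly ?q) z"
  have q: "q \<noteq> 0" using nonroot by (simp add: q_def)
  define L where "L = (\<Sum>i<?n. 1 / (z + of_real (t i)))"
  define M where "M = (\<Sum>i<?n. 1 / (z + of_real (t i))\<^sup>2)"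
  have q': "poly (pderiv (complex_poly ?q)) z = q * L"
    using poly_pderiv_complex[of z] q unfolding q_def L_def zdiff by blast
  have q'': "poly (pderiv (pderiv (complex_poly ?q))) z = q * (L\<^sup>2 - M)"
    using poly_pderiv2_complex[of z] q unfolding q_def L_def M_def zdiff by blast
  have C: "complex_poly (P j) = [:0, 1:] * pderiv (complex_poly (P (Suc j))) -
      smult (of_nat (Suc j)) (complex_poly (P (Suc j)))" for j
    by (subst rec[symmetric]) (simp only: complex_poly_hom of_real_of_nat_eq map_poly_0 of_real_0 of_real_1)
  define N where "N = (of_nat ?n :: complex)"
  \<comment> \<open>The step from \<open>P (k + 2)\<close> subtracts the multiple
    \<open>N = k + 2\<close>, the next one the multiple \<open>N - 1\<close>.\<close>
  have Nk: "of_nat (Suc k) = N - 1" by (simp add: N_def)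
  have e1: "poly (complex_poly (P (Suc k))) z = q * (z * L - N)"
    unfolding C[of "Suc k"] N_def[symmetric] by (simp add: q' q_def[symmetric] algebra_simps)
  have e1': "poly (pderiv (complex_poly (P (Suc k)))) z = q * (L + z * (L\<^sup>2 - M) - N * L)"
    unfolding C[of "Suc k"] N_def[symmetric] pderiv_diff pderiv_mult pderiv_smult
    by (simp add: pderiv_pCons q' q'' algebra_simps)
  have e2: "poly (complex_poly (P k)) z = z * (q * (L + z * (L\<^sup>2 - M) - N * L)) - (N - 1) * (q * (z * L - N))"
    unfolding C[of k] Nk by (simp add: e1 e1' del: of_nat_Suc)
  have "poly (complex_poly (turan P k)) z = q\<^sup>2 * (N - 2 * (z * L) + z\<^sup>2 * M)"
    unfolding turan_def complex_poly_hom
    by (simp add: e1 e2 q_def[symmetric]) (simp add: algebra_simps power2_eq_square)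
  \<comment> \<open>There are exactly \<open>N\<close> zeros, so \<open>N\<close> is a sum of ones
    and each summand becomes the complete square \<open>(1 - x)\<^sup>2\<close> with
    \<open>x = z/(z + t i)\<close>.\<close>
  also have "N - 2 * (z * L) + z\<^sup>2 * M =
      (\<Sum>i<?n. 1 - 2 * (z * (1 / (z + of_real (t i)))) + z\<^sup>2 * (1 / (z + of_real (t i))\<^sup>2))"
    unfolding sum.distrib sum_subtractf L_def M_def N_def sum_distrib_left by simp
  also have "\<dots> = of_real 0 + (\<Sum>i<?n. of_real ((t i)\<^sup>2) / (z + of_real (t i))\<^sup>2)"
    unfolding of_real_0 add_0
  proof (intro sum.cong refl)
    fix i assume "i \<in> {..<?n}"
    define x where "x = z / (z + of_real (t i))"
    have "1 - x = of_real (t i) / (z + of_real (t i))"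
      using zt[of i] \<open>i \<in> {..<?n}\<close> by (simp add: x_def field_simps)
    then have "of_real ((t i)\<^sup>2) / (z + of_real (t i))\<^sup>2 = (1 - x)\<^sup>2"
      by (simp add: power_divide)
    also have "\<dots> = 1 - 2 * x + x\<^sup>2"
      by (simp add: power2_eq_square algebra_simps)
    finally show "1 - 2 * (z * (1 / (z + of_real (t i)))) + z\<^sup>2 * (1 / (z + of_real (t i))\<^sup>2) =
        of_real ((t i)\<^sup>2) / (z + of_real (t i))\<^sup>2"
      by (simp add: x_def power_divide)
  qed
  finally have T: "poly (complex_poly (turan P k)) z =
    q\<^sup>2 * (of_real 0 + (\<Sum>i<?n. of_real ((t i)\<^sup>2) / (z + of_real (t i))\<^sup>2))" .
  \<comment> \<open>Otherwise \<open>P (k + 2)\<close> would be a multiple of a power of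
    \<open>x\<close>, which \<open>x D - (k + 2)\<close> annihilates, although
    \<open>P (k + 1)\<close> does not vanish at \<open>z\<close>.\<close>
  have "\<exists>i<?n. t i \<noteq> 0"
  proof (rule ccontr)
    assume "\<not> (\<exists>i<?n. t i \<noteq> 0)"
    then have "L = (\<Sum>i<?n. 1 / z)" unfolding L_def by (intro sum.cong) auto
    then have "z * L = N" using z by (auto simp: N_def)
    then show False using e1 nonroot[of "Suc k"] by simp
  qed
  then have "of_real 0 + (\<Sum>i<?n. of_real ((t i)\<^sup>2) / (z + of_real (t i))\<^sup>2) \<noteq> 0"
    using z t by (intro sum_weighted_inverse_square_nonzero) (auto intro: add_pos_nonneg)
  then show ?thesis unfolding T using q by simp
qed


section \<open>Part (ii): location of zeros and the Turan expression\<close>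

locale hermite_step = p: real_splitting p n r + q: real_splitting q "Suc n" s
  for p q :: "real poly" and n r s +
  fixes a b c :: real
  assumes degrees: "degree p = n" "degree q = Suc n" and a: "a > 0"
    and step: "q = smult c ([:b, -a:] * p + pderiv p)"
begin

text \<open>Knowing this ratio lets \<open>c\<close> and both leading coefficients, whose signs are
  unknown, drop out when the monic products are compared.\<close>

lemma lead_coeff_step: "lead_coeff q = - (a * c * lead_coeff p)"
proof -
  have "coeff q (Suc n) = - (a * c * coeff p n)"
    using degrees by (subst step) (simp add: coeff_pderiv coeff_eq_0)
  then show ?thesis using degrees by simp
qed

text \<open>At a zero of \<open>p\<close> the step reduces to \<open>q = c p'\<close>; comparing signs at the extreme zero of \<open>p\<close> then
  shows that \<open>q\<close> has a zero at least as far out.\<close>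
lemma linear_products_at_root:
  assumes "poly p x = 0"
  shows "- a * poly (linear_product (Suc n) s) x = poly (pderiv (linear_product n r)) x"
proof -
  have "poly q x = c * poly (pderiv p) x"
    using assms by (subst step) simp
  also have "poly (pderiv p) x = lead_coeff p * poly (pderiv (linear_product n r)) x"
    by (subst p.splits) (simp add: pderiv_smult)
  also have "poly q x = lead_coeff q * poly (linear_product (Suc n) s) x"
    by (subst q.splits) simp
  finally have "c * lead_coeff p * (- a * poly (linear_product (Suc n) s) x) =
      c * lead_coeff p * poly (pderiv (linear_product n r)) x"
    unfolding lead_coeff_step by (simp add: algebra_simps)
  moreover have "c * lead_coeff p \<noteq> 0"
    using q.nonzero lead_coeff_step by auto
  ultimately show ?thesis using mult_left_cancel by blast
qed

text \<open>Otherwise the largest zero \<open>\<mu>\<close> of \<open>p\<close> lies to the right of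
  all zeros of \<open>q\<close>. There the monic product for \<open>q\<close> is positive and the
  one for \<open>p\<close> has nonnegative derivative, but the two values differ by the negative
  factor \<open>- a\<close>.\<close>

lemma root_above:
  assumes "i < n"
  shows "\<exists>j < Suc n. r i \<le> s j"
proof (rule ccontr)
  assume *: "\<not> ?thesis"
  define \<mu> where "\<mu> = Max (r ` {..<n})"
  have "\<mu> \<in> r ` {..<n}" unfolding \<mu>_def using assms by (intro Max_in) auto
  then have "poly p \<mu> = 0" using p.root_nth by auto
  have r: "r j \<le> \<mu>" if "j < n" for j using that by (auto simp: \<mu>_def)
  have s: "s j < \<mu>" if "j < Suc n" for j using * that r[OF assms] by force
  define A where "A = poly (linear_product (Suc n) s) \<mu>"
  have "A \<noteq> 0"
    unfolding A_def poly_linear_product_eq_0_iff using s by (metis less_irrefl)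
  moreover have "A \<ge> 0"
    unfolding A_def using s by (intro linear_product_right_of_roots less_imp_le)
  moreover have "- a * A \<ge> 0"
    unfolding A_def linear_products_at_root[OF \<open>poly p \<mu> = 0\<close>]
    using r by (intro pderiv_linear_product_right_of_roots)
  ultimately show False using a by (simp add: mult_le_0_iff)
qed

lemma root_below:
  assumes "i < n"
  shows "\<exists>j < Suc n. s j \<le> r i"
proof (rule ccontr)
  assume *: "\<not> ?thesis"
  define \<mu> where "\<mu> = Min (r ` {..<n})"
  have "\<mu> \<in> r ` {..<n}" unfolding \<mu>_def using assms by (intro Min_in) auto
  then have "poly p \<mu> = 0" using p.root_nth by auto
  have r: "\<mu> \<le> r j" if "j < n" for j using that by (auto simp: \<mu>_def)
  have s: "\<mu> < s j" if "j < Suc n" for j using * that r[OF assms] by force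
  \<comment> \<open>After reflection the argument for the largest zero applies. The product for
    \<open>q\<close> and the derivative for \<open>p\<close> both acquire the sign
    \<open>(- 1) ^ Suc n\<close>, so their relation keeps its form.\<close>
  define A where "A = poly (linear_product (Suc n) (\<lambda>j. - s j)) (- \<mu>)"
  have A: "A = (- 1) ^ Suc n * poly (linear_product (Suc n) s) \<mu>"
    unfolding A_def by (rule linear_product_reflect)
  have "A \<noteq> 0"
    unfolding A_def poly_linear_product_eq_0_iff using s by (metis less_irrefl neg_equal_iff_equal)
  moreover have "A \<ge> 0"
    unfolding A_def using s by (intro linear_product_right_of_roots) (simp add: less_imp_le)
  moreover have "poly (pderiv (linear_product n (\<lambda>j. - r j))) (- \<mu>) \<ge> 0"
    using r by (intro pderiv_linear_product_right_of_roots) simp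
  then have "(- 1) ^ Suc n * (- a * poly (linear_product (Suc n) s) \<mu>) \<ge> 0"
    unfolding pderiv_linear_product_reflect linear_products_at_root[OF \<open>poly p \<mu> = 0\<close>] by simp
  then have "- (a * A) \<ge> 0" unfolding A by (simp add: algebra_simps)
  ultimately show False using a by (simp add: mult_le_0_iff)
qed

end

context
  fixes P :: "nat \<Rightarrow> real poly" and a b c :: real
  assumes nz: "\<And>k. P k \<noteq> 0" and deg: "\<And>k. degree (P k) = k" and a: "a > 0"
    and rec: "\<And>k. P (Suc k) = smult c ([:b, -a:] * P k + pderiv (P k))"
begin

text \<open>At a zero of \<open>P (Suc k)\<close> that is not one of \<open>P k\<close>,
  \<open>b - a * z + L = 0\<close>. Its imaginary part is \<open>- Im z\<close> times a positive
  number.\<close>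

lemma hermite_real_rooted: "poly (complex_poly (P k)) z = 0 \<Longrightarrow> z \<in> \<real>"
proof (induction k arbitrary: z)
  case 0
  obtain d where "P 0 = [:d:]" using deg[of 0] by (rule degree_eq_zeroE)
  then show ?case using 0 nz[of 0] by (simp add: complex_poly_pCons)
next
  case (Suc k)
  show ?case
  proof (cases "poly (complex_poly (P k)) z = 0")
    case True
    then show ?thesis by (rule Suc.IH)
  next
    case False
    obtain r where "real_splitting (P k) (degree (P k)) r"
      using real_rooted_splitting nz Suc.IH by metis
    then interpret real_splitting "P k" "degree (P k)" r .
    define L where "L = (\<Sum>i<degree (P k). 1 / (z - of_real (r i)))"
    have "c \<noteq> 0" using nz[of "Suc k"] rec[of k] by auto
    have "of_real c * (poly (complex_poly (P k)) z * (of_real b - of_real a * z + L)) =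
        poly (complex_poly (P (Suc k))) z"
      unfolding rec complex_poly_hom poly_smult poly_add poly_mult poly_pderiv_complex[OF False]
      by (simp add: L_def algebra_simps)
    then have "of_real b - of_real a * z + L = 0"
      using Suc.prems False \<open>c \<noteq> 0\<close> by simp
    then have "Im (of_real b - of_real a * z + L) = 0" by simp
    then have "Im z * (a + (\<Sum>i<degree (P k). 1 / (cmod (z - of_real (r i)))\<^sup>2)) = 0"
      unfolding L_def plus_complex.sel Im_sum_inverse_diff_of_real by (simp add: algebra_simps)
    moreover have "a + (\<Sum>i<degree (P k). 1 / (cmod (z - of_real (r i)))\<^sup>2) > 0"
      using a by (intro add_pos_nonneg sum_nonneg) auto
    ultimately show ?thesis by (simp add: complex_is_Real_iff)
  qed
qed

lemma turan_hermite:
  assumes z: "Re z > largest_zero (P (Suc k)) \<or> Re z < smallest_zero (P (Suc k))"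
  shows "poly (complex_poly (turan P k)) z \<noteq> 0"
proof -
  have "\<exists>r. real_splitting (P j) j r" for j
    using real_rooted_splitting[OF nz[of j] hermite_real_rooted[of j]] unfolding deg by blast
  then obtain r s where "real_splitting (P k) k r" "real_splitting (P (Suc k)) (Suc k) s"
    by blast
  interpret real_splitting "P k" k r by fact
  interpret q: real_splitting "P (Suc k)" "Suc k" s by fact
  interpret hermite_step "P k" "P (Suc k)" k r s a b c
    by unfold_locales (rule deg a rec)+
  have fin: "finite {x. poly (P (Suc k)) x = 0}" by (rule poly_roots_finite) (rule nz)
  \<comment> \<open>The zeros of \<open>P k\<close> lie between the extreme zeros of
    \<open>P (Suc k)\<close>, so \<open>z\<close> is beyond all of them on one side.\<close>
  have le: "r i \<le> largest_zero (P (Suc k))" "smallest_zero (P (Suc k)) \<le> r i" if "i < k" for i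
  proof -
    show "r i \<le> largest_zero (P (Suc k))"
      using root_above[OF that] q.root_nth Max_ge[OF fin] unfolding largest_zero_def
      by (metis (mono_tags, lifting) mem_Collect_eq order_trans)
    show "smallest_zero (P (Suc k)) \<le> r i"
      using root_below[OF that] q.root_nth Min_le[OF fin] unfolding smallest_zero_def
      by (metis (mono_tags, lifting) mem_Collect_eq order_trans)
  qed
  define M where "M = (\<Sum>i<k. 1 / (z - of_real (r i))\<^sup>2)"
  have aM: "of_real a + M \<noteq> 0"
    using z
  proof
    assume "Re z > largest_zero (P (Suc k))"
    then have "of_real a + (\<Sum>i<k. of_real 1 / (z + of_real (- r i))\<^sup>2) \<noteq> 0"
      using a le(1) by (intro sum_weighted_inverse_square_nonzero) force+
    then show ?thesis by (simp add: M_def)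
  next
    assume "Re z < smallest_zero (P (Suc k))"
    \<comment> \<open>To the left of the zeros the lemma is applied at \<open>- z\<close>; the
      squares do not change.\<close>
    then have "of_real a + (\<Sum>i<k. of_real 1 / (- z + of_real (r i))\<^sup>2) \<noteq> 0"
      using a le(2) by (intro sum_weighted_inverse_square_nonzero) force+
    then show ?thesis by (simp add: M_def power2_commute)
  qed
  define p where "p = poly (complex_poly (P k)) z"
  have p: "p \<noteq> 0"
  proof
    assume "p = 0"
    then obtain i where "i < k" "z = of_real (r i)" by (auto simp: p_def complex_root_iff)
    then show False using le[of i] z by auto
  qed
  define L where "L = (\<Sum>i<k. 1 / (z - of_real (r i)))"
  have p': "poly (pderiv (complex_poly (P k))) z = p * L"
    using poly_pderiv_complex[of z] p by (simp add: p_def L_def)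
  have p'': "poly (pderiv (pderiv (complex_poly (P k)))) z = p * (L\<^sup>2 - M)"
    using poly_pderiv2_complex[of z] p by (simp add: p_def L_def M_def)
  define ca cb cc where "ca = complex_of_real a" and "cb = complex_of_real b" and "cc = complex_of_real c"
  have C: "complex_poly (P (Suc j)) = smult cc ([:cb, - ca:] * complex_poly (P j) + pderiv (complex_poly (P j)))" for j
    unfolding rec complex_poly_hom by (simp add: ca_def cb_def cc_def)
  define l where "l = cb - ca * z"
  have lz: "poly [:cb, - ca:] z = l" by (simp add: l_def)
  have e1: "poly (complex_poly (P (Suc k))) z = cc * p * (l + L)"
    unfolding C[of k] poly_smult poly_add poly_mult lz p' p_def[symmetric] by (simp add: algebra_simps)
  \<comment> \<open>The term \<open>- ca\<close> is the derivative of the linear factor. In the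
    Turan expression it survives as \<open>ca\<close>, next to \<open>M\<close>, while all terms in
    \<open>l\<close> and \<open>L\<close> cancel.\<close>
  have e1': "poly (pderiv (complex_poly (P (Suc k)))) z = cc * p * (l * L - ca + (L\<^sup>2 - M))"
    unfolding C[of k] pderiv_smult pderiv_add pderiv_mult poly_smult poly_add poly_mult lz p' p'' p_def[symmetric]
    by (simp add: pderiv_pCons algebra_simps)
  have e2: "poly (complex_poly (P (Suc (Suc k)))) z =
      cc * (l * (cc * p * (l + L)) + cc * p * (l * L - ca + (L\<^sup>2 - M)))"
    unfolding C[of "Suc k"] poly_smult poly_add poly_mult lz e1 e1' ..
  have "poly (complex_poly (turan P k)) z = cc\<^sup>2 * p\<^sup>2 * (ca + M)"
    unfolding turan_def complex_poly_hom
    by (simp add: e1 e2 p_def[symmetric]) (simp add: algebra_simps power2_eq_square)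
  moreover have "cc \<noteq> 0" using nz[of "Suc k"] rec[of k] by (auto simp: cc_def)
  ultimately show ?thesis using p aM by (simp add: ca_def)
qed

end

section \<open>Assembly of the three statements\<close>

text \<open>The zero polynomial also has \<open>degree\<close> 0, so nonvanishing is stated
  separately. Real-rootedness is expressed by letting the zeros range over the complex
  numbers.\<close>

theorem theorem1p1:
  fixes P :: "nat \<Rightarrow> real poly"
  assumes deg: "\<And>k. P k \<noteq> 0 \<and> degree (P k) = k"
  shows
    "(\<forall>(a::real) (b::real) (c::nat \<Rightarrow> real).
        a \<noteq> 0 \<and> b \<ge> 0 \<and> (\<forall>k. c (k + 1) \<ge> c k \<and> c k > 0) \<and>
        (\<forall>k. P (k + 1) = smult a ([:b, 1:] * (pderiv (P k) + smult (c k) (P k)))) \<longrightarrow>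
        (\<forall>k. weakly_hurwitz_stable (complex_poly (pcompose (turan P k) [:-b, 1:]))))
   \<and> (\<forall>(a::real) (b::real) (c::real).
        a > 0 \<and>
        (\<forall>k. P (k + 1) = smult c ([:b, -a:] * P k + pderiv (P k))) \<longrightarrow>
        (\<forall>k\<ge>1. \<forall>z. poly (complex_poly (P k)) z = 0 \<longrightarrow> z \<in> \<real>) \<and>
        (\<forall>k z. Re z > largest_zero (P (k + 1)) \<or> Re z < smallest_zero (P (k + 1)) \<longrightarrow>
          poly (complex_poly (turan P k)) z \<noteq> 0))
   \<and> ((\<forall>k\<ge>1. [:0, 1:] * pderiv (P k) - smult (real k) (P k) = P (k - 1)) \<and>
        (\<forall>k z. poly (complex_poly (P k)) z = 0 \<longrightarrow> z \<in> \<real> \<and> Re z \<le> 0) \<longrightarrow>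
        (\<forall>k. weakly_hurwitz_stable (complex_poly (turan P k))))"
proof (intro conjI allI impI; (elim conjE)?)
  fix a b :: real and c :: "nat \<Rightarrow> real" and k
  assume a: "a \<noteq> 0" and c: "\<forall>k. c (k + 1) \<ge> c k \<and> c k > 0"
    and rec: "\<forall>k. P (k + 1) = smult a ([:b, 1:] * (pderiv (P k) + smult (c k) (P k)))"
  show "weakly_hurwitz_stable (complex_poly (pcompose (turan P k) [:-b, 1:]))"
    unfolding weakly_hurwitz_stable_def complex_poly_pcompose poly_pcompose
    using turan_multiplier_differentiation[of P c a b _ k] deg a c rec
    by (auto simp: complex_poly_pCons)
next
  fix a b c :: real and k z
  assume "a > 0" "\<forall>k. P (k + 1) = smult c ([:b, -a:] * P k + pderiv (P k))"
    and "poly (complex_poly (P k)) z = 0"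
  then show "z \<in> \<real>" using hermite_real_rooted[of P a c b k z] deg by auto
next
  fix a b c :: real and k z
  assume "a > 0" "\<forall>k. P (k + 1) = smult c ([:b, -a:] * P k + pderiv (P k))"
    and "Re z > largest_zero (P (k + 1)) \<or> Re z < smallest_zero (P (k + 1))"
  then show "poly (complex_poly (turan P k)) z \<noteq> 0" using turan_hermite[of P a c b k z] deg by auto
next
  fix k
  assume "\<forall>k\<ge>1. [:0, 1:] * pderiv (P k) - smult (real k) (P k) = P (k - 1)"
    and "\<forall>k z. poly (complex_poly (P k)) z = 0 \<longrightarrow> z \<in> \<real> \<and> Re z \<le> 0"
  \<comment> \<open>Passing to \<open>Suc k\<close> removes the truncated subtraction in
    \<open>P (k - 1)\<close>.\<close>
  moreover from this(1) have "[:0, 1:] * pderiv (P (Suc k)) - smult (real (Suc k)) (P (Suc k)) = P k" for k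
    by (metis One_nat_def Suc_le_mono diff_Suc_1 le0)
  ultimately show "weakly_hurwitz_stable (complex_poly (turan P k))"
    unfolding weakly_hurwitz_stable_def using turan_euler_operator[of P _ k] deg by blast
qed

end
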